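(* Let $r\ge3$ be a fixed integer and $s>\frac{r}{r-1}$ a fixed real number. Then: (i) for every fixed positive integer $t$ and all sufficiently large $n$, $\operatorname{ex}_r(n,\mathcal F_{r,s,t})\ge\frac1r n^{r-r/s}$; (ii) for every $\varepsilon>0$ there is a positive integer $T=T(r,s,\varepsilon)$ such that, for all sufficiently large $n$, $\operatorname{ex}_r(n,\mathcal F_{r,s,T})<\frac1r n^{r-r/s+\varepsilon}$; (iii) consequently $$\lim_{t\to\infty}\limsup_{n\to\infty}\frac{\log\operatorname{ex}_r(n,\mathcal F_{r,s,t})}{\log n}=r-\frac rs.$$
   Context: An $r$-graph ($r$-uniform hypergraph) is a pair $H=(V(H),E(H))$ with $V(H)$ a finite set and $E(H)\subseteq\binom{V(H)}{r}$; $e(H)=|E(H)|$. An $r$-graph $F$ is a subhypergraph of $H$ if $V(F)\subseteq V(H)$ and $E(F)\subseteq E(H)$. The average degree of an $r$-graph $H$ with nonempty vertex set is $\overline d(H)=r\,e(H)/|V(H)|$. For a positive integer $t$, $\mathcal F_{r,s,t}$ is the family of all (nonempty) $r$-graphs on at most $t$ vertices with average degree at least $s$. For a family $\mathcal F$ of $r$-graphs, $\operatorname{ex}_r(n,\mathcal F)$ is the maximum number of edges in an $n$-vertex $r$-graph containing no member of $\mathcal F$ as a subhypergraph (up to isomorphism). *)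

theory Defs
  imports Complex_Main "HOL-Library.Extended_Real" "HOL-Library.Liminf_Limsup"
begin

type_synonym 'a hypergraph = "'a set \<times> 'a set set"

abbreviation verts :: "'a hypergraph \<Rightarrow> 'a set" where
  "verts H \<equiv> fst H"

abbreviation hedges :: "'a hypergraph \<Rightarrow> 'a set set" where
  "hedges H \<equiv> snd H"

definition rgraph :: "nat \<Rightarrow> 'a hypergraph \<Rightarrow> bool" where
  "rgraph r H \<longleftrightarrow> finite (verts H) \<and> hedges H \<subseteq> {e. e \<subseteq> verts H \<and> card e = r}"

definition subhypergraph :: "'a hypergraph \<Rightarrow> 'a hypergraph \<Rightarrow> bool" where
  "subhypergraph F H \<longleftrightarrow> verts F \<subseteq> verts H \<and> hedges F \<subseteq> hedges H"

definition hypergraph_iso :: "'a hypergraph \<Rightarrow> 'b hypergraph \<Rightarrow> bool" where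
  "hypergraph_iso F G \<longleftrightarrow>
     (\<exists>f. bij_betw f (verts F) (verts G) \<and> (\<lambda>e. f ` e) ` hedges F = hedges G)"

definition contains_copy :: "'b hypergraph \<Rightarrow> 'a hypergraph \<Rightarrow> bool" where
  "contains_copy H F \<longleftrightarrow> (\<exists>F'. subhypergraph F' H \<and> hypergraph_iso F F')"

definition avg_degree :: "nat \<Rightarrow> 'a hypergraph \<Rightarrow> real" where
  "avg_degree r H = real r * real (card (hedges H)) / real (card (verts H))"

text \<open>Since containment is only up to isomorphism, it is enough to let forbidden and host
  hypergraphs range over those whose vertices are natural numbers.\<close>

definition dense_family :: "nat \<Rightarrow> real \<Rightarrow> nat \<Rightarrow> nat hypergraph set" where
  "dense_family r s t =
     {F. rgraph r F \<and> verts F \<noteq> {} \<and> card (verts F) \<le> t \<and> avg_degree r F \<ge> s}"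

text \<open>The set of values is bounded by \<open>n choose r\<close>. It is nonempty whenever every forbidden
  hypergraph has an edge, as is the case for \<open>dense_family r s t\<close> with \<open>s > 0\<close>.\<close>

definition ex_number :: "nat \<Rightarrow> nat \<Rightarrow> nat hypergraph set \<Rightarrow> nat" where
  "ex_number r n \<F> =
     Max {card (hedges H) | H :: nat hypergraph.
            rgraph r H \<and> card (verts H) = n \<and> (\<forall>F\<in>\<F>. \<not> contains_copy H F)}"

end

(* Write rho = s/r, so that forbidden subgraphs are those in which some set U of at most t vertices
   spans at least rho |U| edges.

   Lower bound: choose each r-set with probability p = C n^(-1/rho). For each v the expected number
   of sets of v vertices spanning rho v edges is O(n^v p^(rho v)) = O(1), so deleting one edge for
   each of them costs only a constant.

   Upper bound, after Bukh and Conlon: pass to a subgraph of minimum degree about n^(r-1-1/rho+eps)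
   and count walks of b distinct edges along a "caterpillar" in which each edge has, on average,
   slightly fewer than 1/rho unrooted vertices. There are more walks than choices of roots, so many
   walks share their roots. The caterpillar is balanced, hence adding to a set U containing these
   roots a walk that does not stay within U creates more than rho new edges per new vertex. Iterating,
   the bounded number of roots becomes negligible. Walks may revisit vertices: only the distinctness
   of their edges is needed, so no codegree condition enters. *)
theory Submission
  imports Defs "HOL-Library.FuncSet"
begin

section \<open>Caterpillar walks\<close>

lemma choose_le_power: "n choose k \<le> n ^ k"
  by (cases "k \<le> n") (auto simp: binomial_le_pow binomial_eq_0)

text \<open>In a walk, consecutive edges share a spine vertex. At edge \<open>e\<close> with spine vertex \<open>v\<close>, the other
  vertices are \<open>nx v e\<close>, the possible next spine vertex, the set \<open>Rt v e\<close> of roots, and \<open>q\<close> free vertices.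
  The fraction \<open>P / Q\<close> prescribes how often the spine moves on, so that asymptotically each edge has
  \<open>q + P / Q\<close> unrooted vertices.\<close>

locale caterpillar =
  fixes E :: "'a set set" and s0 :: 'a and nx :: "'a \<Rightarrow> 'a set \<Rightarrow> 'a"
    and Rt :: "'a \<Rightarrow> 'a set \<Rightarrow> 'a set" and r q P Q K :: nat
  assumes finE: "finite E"
    and card_edge: "\<And>e. e \<in> E \<Longrightarrow> finite e \<and> card e = r"
    and nx: "\<And>e v. e \<in> E \<Longrightarrow> v \<in> e \<Longrightarrow> nx v e \<in> e - {v}"
    and Rt: "\<And>e v. e \<in> E \<Longrightarrow> v \<in> e \<Longrightarrow> Rt v e \<subseteq> e - {v, nx v e} \<and> card (Rt v e) = r - 2 - q"
    and q: "q + 2 \<le> r" and P: "0 < P" "P < Q"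
begin

abbreviation b where "b \<equiv> Q * K"

text \<open>Edge \<open>i\<close> occupies the cell \<open>{i * P..<i * P + P}\<close> of the integers, and the spine vertex of level \<open>l\<close>
  the longer interval \<open>{l * Q..<l * Q + Q}\<close>; \<open>lev i\<close> is the level of the interval in which cell \<open>i\<close>
  begins. The spine must not move at the last edge, as its new end would lie in a single edge only.\<close>

definition lev :: "nat \<Rightarrow> nat" where "lev i = i * P div Q"

definition adv :: "nat \<Rightarrow> bool" where "adv i \<longleftrightarrow> lev i < lev (Suc i) \<and> Suc i < b"

primrec sp :: "'a set list \<Rightarrow> nat \<Rightarrow> 'a" where
  "sp fs 0 = s0"
| "sp fs (Suc i) = (if adv i then nx (sp fs i) (fs ! i) else sp fs i)"

definition walks :: "nat \<Rightarrow> 'a set list set" where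
  "walks k = {fs. length fs = k \<and> distinct fs \<and> set fs \<subseteq> E \<and> (\<forall>i<k. sp fs i \<in> fs ! i)}"

text \<open>If the spine stays put at edge \<open>i\<close>, the candidate next vertex does not
  become a spine vertex, so it is rooted as well. Edge \<open>i\<close> thus leaves \<open>q\<close>
  vertices besides its spine vertex unrooted, and one more when the spine moves.\<close>

definition roots :: "'a set list \<Rightarrow> nat \<Rightarrow> 'a set" where
  "roots fs i = (if adv i then Rt (sp fs i) (fs ! i)
                 else insert (nx (sp fs i) (fs ! i)) (Rt (sp fs i) (fs ! i)))"

lemma lev_mono: "i \<le> j \<Longrightarrow> lev i \<le> lev j"
  by (simp add: lev_def div_le_mono)

text \<open>A cell is shorter than an interval, as \<open>P < Q\<close>, so passing to the next cell
  crosses at most one interval boundary.\<close>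

lemma lev_Suc_le: "lev (Suc i) \<le> Suc (lev i)"
proof -
  have "lev (Suc i) \<le> (i * P + Q) div Q"
    unfolding lev_def using P by (intro div_le_mono) simp
  then show ?thesis using P by (simp add: lev_def)
qed

lemma lev_b: "lev b = K * P"
  using P by (simp add: lev_def mult.assoc)

lemma sp_eq:
  assumes "i \<le> j" "j < b" "lev i = lev j"
  shows "sp fs i = sp fs j"
  using assms
proof (induction j rule: dec_induct)
  case (step j)
  have "lev i \<le> lev j" "lev j \<le> lev (Suc j)"
    by (rule lev_mono, use step in simp)+
  then have "lev j = lev (Suc j)" using step by simp
  then show ?case using step by (simp add: adv_def)
qed simp

lemma sp_eq':
  assumes "i < b" "j < b" "lev i = lev j"
  shows "sp fs i = sp fs j"
proof (cases "i \<le> j")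
  case True
  then show ?thesis using assms(2,3) by (rule sp_eq)
next
  case False
  then have "sp fs j = sp fs i" by (intro sp_eq) (simp_all add: assms)
  then show ?thesis by simp
qed

lemma sp_append: "i \<le> length fs \<Longrightarrow> sp (fs @ gs) i = sp fs i"
  by (induction i) (auto simp: nth_append)

text \<open>The spine vertex of a level lies in every edge whose cell meets the interval of that level.\<close>

lemma spine_cell:
  assumes fs: "fs \<in> walks b" and i: "i < b" and x: "x div Q = lev i"
  shows "x div P < b \<and> sp fs i \<in> fs ! (x div P)"
proof -
  define k where "k = x div P"
  \<comment> \<open>The interval of level \<open>K * P\<close> starts at the integer
    \<open>b * P\<close>, where the last cell ends. Hence the whole interval of \<open>lev i\<close>
    is covered by cells of edges of the walk.\<close>
  have "lev i < K * P"
  proof -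
    have "i * P < b * P" using i P by simp
    then have "i * P < K * P * Q" by (simp only: ac_simps)
    then show ?thesis unfolding lev_def by (rule less_mult_imp_div_less)
  qed
  then have "x div Q < K * P" using x by simp
  then have "x < K * P * Q" using P by (simp add: div_less_iff_less_mult)
  then have "x < b * P" by (simp only: ac_simps)
  then have k: "k < b" unfolding k_def using P by (simp add: div_less_iff_less_mult)
  \<comment> \<open>Cell \<open>k\<close> either begins inside the interval of \<open>lev i\<close>
    or runs into it from the preceding one. In the latter case the spine moves at \<open>k\<close>,
    and its new vertex still belongs to edge \<open>k\<close>.\<close>
  have "k * P \<le> x" unfolding k_def by simp
  then have l1: "lev k \<le> lev i" unfolding x[symmetric] unfolding lev_def by (rule div_le_mono)
  have "x \<le> Suc k * P" unfolding k_def using P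
    by (simp add: dividend_less_div_times less_imp_le)
  then have l2: "lev i \<le> lev (Suc k)" unfolding x[symmetric] unfolding lev_def by (rule div_le_mono)
  have mem: "sp fs k \<in> fs ! k" "fs ! k \<in> E" using fs k by (auto simp: walks_def)
  show ?thesis
  proof (cases "lev k = lev i")
    case True
    then have "sp fs k = sp fs i" using k i by (rule sp_eq'[rotated 2])
    then show ?thesis using mem k by (simp add: k_def)
  next
    case False
    then have l: "lev (Suc k) = lev i" "lev k < lev (Suc k)" using l1 l2 lev_Suc_le[of k] by auto
    \<comment> \<open>Excluding the last edge from \<open>adv\<close> does no harm here: the level
      at \<open>b\<close> is \<open>K * P\<close>, which no edge of the walk attains.\<close>
    then have "Suc k \<noteq> b" using lev_b \<open>lev i < K * P\<close> by (metis less_irrefl)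
    then have "Suc k < b" using k by simp
    then have "adv k" and "sp fs (Suc k) = sp fs i"
      using l i sp_eq'[of "Suc k" i fs] by (simp_all add: adv_def)
    then have "sp fs i = nx (sp fs k) (fs ! k)" by (simp only: sp.simps if_True)
    then show ?thesis using nx[OF mem(2,1)] k unfolding k_def by (metis DiffD1)
  qed
qed

text \<open>Balancedness. As the intervals are disjoint, at least \<open>Q / P\<close> times as many cells as there are
  spine vertices in \<open>W\<close> are hit, and each edge hit adds at most \<open>q\<close> further vertices.\<close>

lemma growth:
  assumes fs: "fs \<in> walks b" and s0: "s0 \<in> U" and ro: "\<And>i. i < b \<Longrightarrow> roots fs i \<subseteq> U"
  defines "W \<equiv> \<Union>(set fs) - U"
  shows "Q * card W \<le> (Q * q + P) * card {e \<in> set fs. e \<inter> W \<noteq> {}}"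
proof -
  have len: "length fs = b" and dist: "distinct fs" and fE: "\<And>i. i < b \<Longrightarrow> fs ! i \<in> E"
    and spm: "\<And>i. i < b \<Longrightarrow> sp fs i \<in> fs ! i"
    using fs by (auto simp: walks_def)
  \<comment> \<open>The edges met by new vertices are indexed by \<open>J\<close>, those with a new
    spine vertex by \<open>I\<close>; \<open>Pr i\<close> consists of the \<open>q\<close> free
    vertices of edge \<open>i\<close>.\<close>
  define J where "J = {i. i < b \<and> fs ! i \<inter> W \<noteq> {}}"
  define I where "I = {i. i < b \<and> sp fs i \<in> W}"
  define Pr where "Pr i = fs ! i - {sp fs i, nx (sp fs i) (fs ! i)} - Rt (sp fs i) (fs ! i)" for i
  have finJ: "finite J" and finI: "finite I" by (auto simp: J_def I_def)
  have cardJ: "card J = card {e \<in> set fs. e \<inter> W \<noteq> {}}"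
  proof -
    have "{e \<in> set fs. e \<inter> W \<noteq> {}} = (\<lambda>i. fs ! i) ` J"
      by (auto simp: J_def in_set_conv_nth len)
    moreover have "inj_on (\<lambda>i. fs ! i) J"
      using dist by (auto simp: J_def inj_on_def nth_eq_iff_index_eq len)
    ultimately show ?thesis by (simp add: card_image)
  qed
  have cPr: "finite (Pr i) \<and> card (Pr i) = q" if "i < b" for i
  proof -
    have 1: "finite (fs ! i)" "card (fs ! i) = r" using card_edge fE that by auto
    have 2: "nx (sp fs i) (fs ! i) \<in> fs ! i - {sp fs i}" using nx fE spm that by auto
    have 3: "Rt (sp fs i) (fs ! i) \<subseteq> fs ! i - {sp fs i, nx (sp fs i) (fs ! i)}"
      "card (Rt (sp fs i) (fs ! i)) = r - 2 - q" using Rt fE spm that by auto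
    have "card (fs ! i - {sp fs i, nx (sp fs i) (fs ! i)}) = r - 2"
      using 1 2 spm[OF that] by (subst card_Diff_subset) auto
    then show ?thesis
      unfolding Pr_def using 1 3 q by (subst card_Diff_subset) (auto intro: finite_subset)
  qed
  have W_sub: "W \<subseteq> (\<Union>i\<in>J. Pr i) \<union> sp fs ` I"
  proof
    fix w assume w: "w \<in> W"
    then obtain i where i: "i < b" "w \<in> fs ! i"
      unfolding W_def by (auto simp: in_set_conv_nth len)
    then have J: "i \<in> J" using w by (auto simp: J_def)
    have wU: "w \<notin> roots fs i" using ro i w by (auto simp: W_def)
    then have wR: "w \<notin> Rt (sp fs i) (fs ! i)" by (auto simp: roots_def split: if_splits)
    consider "w = sp fs i" | "w = nx (sp fs i) (fs ! i)" | "w \<in> Pr i"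
      using wR i by (auto simp: Pr_def)
    then show "w \<in> (\<Union>i\<in>J. Pr i) \<union> sp fs ` I"
    proof cases
      case 1 then show ?thesis using i w by (auto simp: I_def)
    next
      case 2
      then have a: "adv i" using wU by (auto simp: roots_def split: if_splits)
      \<comment> \<open>Here the exclusion of the last edge in \<open>adv\<close> matters: the new
        spine vertex is the spine vertex of a further edge of the walk.\<close>
      then have "Suc i \<in> I" "w = sp fs (Suc i)" using 2 w by (auto simp: I_def adv_def)
      then show ?thesis by blast
    next
      case 3 then show ?thesis using J by blast
    qed
  qed
  have "card (\<Union>i\<in>J. Pr i) \<le> (\<Sum>i\<in>J. card (Pr i))" using finJ by (rule card_UN_le)
  also have "\<dots> = card J * q" using cPr by (simp add: J_def)
  finally have c1: "card (\<Union>i\<in>J. Pr i) \<le> card J * q" .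
  \<comment> \<open>Edges of one level share their spine vertex. Different levels may share one too,
    since walks may revisit vertices, hence the inequality.\<close>
  have c2: "card (sp fs ` I) \<le> card (lev ` I)"
  proof -
    have "sp fs ` I \<subseteq> (\<lambda>l. sp fs (SOME i. i \<in> I \<and> lev i = l)) ` lev ` I"
    proof
      fix w assume "w \<in> sp fs ` I"
      then obtain i where i: "i \<in> I" "w = sp fs i" by auto
      define k where "k = (SOME k. k \<in> I \<and> lev k = lev i)"
      have "k \<in> I \<and> lev k = lev i" unfolding k_def by (rule someI[of _ i]) (use i in auto)
      then have "sp fs k = sp fs i" using i by (intro sp_eq') (auto simp: I_def)
      then show "w \<in> (\<lambda>l. sp fs (SOME i. i \<in> I \<and> lev i = l)) ` lev ` I"
        using i unfolding k_def by force
    qed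
    then show ?thesis using finI by (meson surj_card_le finite_imageI)
  qed
  define N where "N = (\<Union>l\<in>lev ` I. {l * Q..<l * Q + Q})"
  have c3: "card N = Q * card (lev ` I)"
  proof -
    have "x = y" if "z \<in> {x * Q..<x * Q + Q}" "z \<in> {y * Q..<y * Q + Q}" for x y z
      using div_nat_eqI[of Q x z] div_nat_eqI[of Q y z] that by (simp add: algebra_simps)
    then have "card N = (\<Sum>l\<in>lev ` I. card {l * Q..<l * Q + Q})"
      unfolding N_def using finI by (intro card_UN_disjoint) blast+
    then show ?thesis by simp
  qed
  \<comment> \<open>By \<open>spine_cell\<close>, a cell that meets the interval of a new spine
    vertex belongs to an edge containing that vertex, hence to an edge in \<open>J\<close>.\<close>
  have N_sub: "N \<subseteq> (\<Union>i\<in>J. {i * P..<i * P + P})"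
  proof
    fix x assume "x \<in> N"
    then obtain i where i: "i \<in> I" "lev i * Q \<le> x" "x < lev i * Q + Q" by (auto simp: N_def)
    then have "x div Q = lev i"
      by (intro div_nat_eqI) (auto simp: algebra_simps)
    then have "x div P < b" "sp fs i \<in> fs ! (x div P)" using spine_cell[OF fs, of i x] i by (auto simp: I_def)
    then have J: "x div P \<in> J" using i by (auto simp: J_def I_def)
    have "x div P * P \<le> x" "x < x div P * P + P" using P dividend_less_div_times[of P x] by (auto simp: add.commute)
    then show "x \<in> (\<Union>i\<in>J. {i * P..<i * P + P})" using J by (intro UN_I[of "x div P"]) auto
  qed
  have "card N \<le> card (\<Union>i\<in>J. {i * P..<i * P + P})" using finJ N_sub by (intro card_mono) auto
  also have "\<dots> \<le> (\<Sum>i\<in>J. card {i * P..<i * P + P})" using finJ by (rule card_UN_le)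
  also have "\<dots> = card J * P" by simp
  finally have c4: "Q * card (lev ` I) \<le> card J * P" using c3 by simp
  have "card W \<le> card ((\<Union>i\<in>J. Pr i) \<union> sp fs ` I)"
    using W_sub finJ finI cPr by (intro card_mono) (auto simp: J_def)
  also have "\<dots> \<le> card J * q + card (lev ` I)"
    using card_Un_le[of "\<Union>i\<in>J. Pr i" "sp fs ` I"] c1 c2 by linarith
  finally have "Q * card W \<le> Q * (card J * q) + Q * card (lev ` I)"
    by (metis add_mult_distrib2 mult_le_mono2)
  also have "\<dots> \<le> Q * (card J * q) + card J * P" using c4 by simp
  finally show ?thesis unfolding cardJ by (simp add: algebra_simps)
qed

section \<open>Counting walks and choices of roots\<close>

lemma card_adv: "K * P \<le> Suc (card {i. i < b \<and> adv i})"
proof -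
  \<comment> \<open>\<open>lev\<close> climbs from 0 to \<open>K * P\<close> by at most one per
    edge, so it must rise at least \<open>K * P\<close> times.\<close>
  have "lev k \<le> card {i. i < k \<and> lev i < lev (Suc i)}" for k
  proof (induction k)
    case (Suc k)
    have "{i. i < Suc k \<and> lev i < lev (Suc i)} =
      (if lev k < lev (Suc k) then insert k {i. i < k \<and> lev i < lev (Suc i)} else {i. i < k \<and> lev i < lev (Suc i)})"
      by (auto simp: less_Suc_eq)
    then show ?case using Suc lev_Suc_le[of k] by auto
  qed (simp add: lev_def)
  from this[of b] have "K * P \<le> card {i. i < b \<and> lev i < lev (Suc i)}" by (simp add: lev_b)
  \<comment> \<open>Only a rise at the last edge fails to be an advance; this is the
    \<open>Suc\<close> in the bound.\<close>
  also have "\<dots> \<le> card (insert (b - 1) {i. i < b \<and> adv i})"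
    by (intro card_mono) (auto simp: adv_def)
  also have "\<dots> \<le> Suc (card {i. i < b \<and> adv i})" by (simp add: card_insert_if)
  finally show ?thesis .
qed

lemma finite_walks: "finite (walks k)"
  by (rule finite_subset[OF _ finite_lists_length_eq[OF finE, of k]]) (auto simp: walks_def)

text \<open>Greedy extension: the current spine vertex lies in at least \<open>d + k\<close> edges,
  of which the walk has used at most \<open>k\<close>, so at least \<open>d\<close> choices remain
  at each step.\<close>

lemma card_walks:
  assumes deg: "\<And>v. v \<in> \<Union>E \<Longrightarrow> d + k \<le> card {e \<in> E. v \<in> e}" and s0: "s0 \<in> \<Union>E"
  shows "j \<le> k \<Longrightarrow> d ^ j \<le> card (walks j)"
proof (induction j)
  case 0
  have "walks 0 = {[]}" by (auto simp: walks_def)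
  then show ?case by simp
next
  case (Suc j)
  define A where "A fs = {e \<in> E. sp fs j \<in> e} - set fs" for fs
  have spE: "sp fs i \<in> \<Union>E" if "fs \<in> walks j" "i \<le> j" for fs i
    using that(2)
  proof (induction i)
    case (Suc i)
    then have "fs ! i \<in> E" "sp fs i \<in> fs ! i" using that by (auto simp: walks_def)
    then show ?case using nx Suc by auto
  qed (use s0 in simp)
  have cA: "d \<le> card (A fs)" if "fs \<in> walks j" for fs
  proof -
    have "d + k \<le> card {e \<in> E. sp fs j \<in> e}" using deg spE[OF that] by simp
    moreover have "card (set fs) \<le> k" using that Suc.prems card_length[of fs] by (auto simp: walks_def)
    ultimately show ?thesis unfolding A_def
      using diff_card_le_card_Diff[of "set fs" "{e \<in> E. sp fs j \<in> e}"] by simp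
  qed
  have sub: "(\<lambda>(fs, e). fs @ [e]) ` (SIGMA fs:walks j. A fs) \<subseteq> walks (Suc j)"
    by (auto simp: walks_def A_def sp_append nth_append less_Suc_eq)
  have "d ^ Suc j \<le> card (walks j) * d" using Suc by simp
  also have "\<dots> = (\<Sum>fs\<in>walks j. d)" by simp
  also have "\<dots> \<le> (\<Sum>fs\<in>walks j. card (A fs))" by (rule sum_mono) (rule cA)
  also have "\<dots> = card (SIGMA fs:walks j. A fs)"
    using finE by (subst card_SigmaI) (auto simp: finite_walks A_def)
  also have "\<dots> = card ((\<lambda>(fs, e). fs @ [e]) ` (SIGMA fs:walks j. A fs))"
    by (rule card_image[symmetric]) (auto simp: inj_on_def)
  also have "\<dots> \<le> card (walks (Suc j))" by (rule card_mono[OF finite_walks sub])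
  finally show ?case .
qed

text \<open>An edge has \<open>r - 1 - q\<close> roots, and one fewer where the spine moves; by
  \<open>card_adv\<close> this saves at least \<open>K * P - 1\<close> roots in all. The saving
  appears as a factor on the left to avoid a quotient.\<close>

lemma card_root_maps:
  assumes V: "finite V" "\<Union>E \<subseteq> V" "V \<noteq> {}"
  shows "card ((\<lambda>fs. restrict (roots fs) {..<b}) ` walks b) * card V ^ (K * P - 1) \<le> card V ^ (b * (r - 1 - q))"
proof -
  define c where "c i = (if adv i then r - 2 - q else r - 1 - q)" for i
  have n: "card V \<ge> 1" using V by (simp add: Suc_leI card_gt_0_iff)
  have croots: "roots fs i \<subseteq> V \<and> card (roots fs i) = c i" if "fs \<in> walks b" "i < b" for fs i
  proof -
    have e: "fs ! i \<in> E" "sp fs i \<in> fs ! i" using that by (auto simp: walks_def)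
    note R = Rt[OF e] and N = nx[OF e]
    have "finite (Rt (sp fs i) (fs ! i))" using R card_edge[OF e(1)] by (meson finite_Diff finite_subset)
    moreover have "nx (sp fs i) (fs ! i) \<notin> Rt (sp fs i) (fs ! i)" using R by auto
    ultimately have "card (roots fs i) = c i" using R q by (auto simp: roots_def c_def)
    moreover have "roots fs i \<subseteq> fs ! i" using R N by (auto simp: roots_def)
    ultimately show ?thesis using e V by blast
  qed
  have "(\<lambda>fs. restrict (roots fs) {..<b}) ` walks b \<subseteq> PiE {..<b} (\<lambda>i. {A. A \<subseteq> V \<and> card A = c i})"
    using croots by (auto simp: PiE_iff extensional_def) blast
  then have "card ((\<lambda>fs. restrict (roots fs) {..<b}) ` walks b) \<le> card (PiE {..<b} (\<lambda>i. {A. A \<subseteq> V \<and> card A = c i}))"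
    using V by (intro card_mono finite_PiE) auto
  also have "\<dots> = (\<Prod>i<b. card V choose c i)"
    using V by (simp add: card_PiE n_subsets)
  also have "\<dots> \<le> (\<Prod>i<b. card V ^ c i)"
    by (intro prod_mono conjI) (auto intro: choose_le_power)
  also have "\<dots> = card V ^ (\<Sum>i<b. c i)" by (simp add: power_sum)
  finally have 1: "card ((\<lambda>fs. restrict (roots fs) {..<b}) ` walks b) \<le> card V ^ (\<Sum>i<b. c i)" .
  have "(\<Sum>i<b. c i) + card {i. i < b \<and> adv i} = (\<Sum>i<b. c i + (if adv i then 1 else 0))"
    by (simp add: sum.distrib sum.If_cases Int_def)
  also have "\<dots> = (\<Sum>i<b. r - 1 - q)" using q by (intro sum.cong) (auto simp: c_def)
  also have "\<dots> = b * (r - 1 - q)" by simp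
  finally have "(\<Sum>i<b. c i) + (K * P - 1) \<le> b * (r - 1 - q)" using card_adv by linarith
  then have "card V ^ ((\<Sum>i<b. c i) + (K * P - 1)) \<le> card V ^ (b * (r - 1 - q))"
    using n by (intro power_increasing) auto
  then show ?thesis using 1 by (simp add: power_add) (meson le_trans mult_le_mono1)
qed

text \<open>By \<open>big\<close>, walks outnumber choices of roots by a factor above
  \<open>2 ^ (M * b)\<close>, which bounds the number of lists of \<open>b\<close> subsets of a set
  of at most \<open>M\<close> vertices. The last summand of the conclusion pays for the initial set
  of roots. A walk adds at most \<open>b * r\<close> vertices, so the enlargement stops only within
  \<open>b * r\<close> of \<open>M\<close>.\<close>

lemma dense_set:
  assumes V: "finite V" "\<Union>E \<subseteq> V" and s0: "s0 \<in> \<Union>E"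
    and deg: "\<And>v. v \<in> \<Union>E \<Longrightarrow> d + b \<le> card {e \<in> E. v \<in> e}"
    and M: "1 + b * r \<le> M"
    and big: "2 ^ (M * b) * card V ^ (b * (r - 1 - q)) < d ^ b * card V ^ (K * P - 1)"
  shows "\<exists>U \<subseteq> V. card U \<le> M \<and> M < card U + b * r \<and>
           Q * card U \<le> (Q * q + P) * card {e \<in> E. e \<subseteq> U} + Q * (1 + b * r)"
proof -
  define \<rho> where "\<rho> = (\<lambda>fs. restrict (roots fs) {..<b})"
  have V0: "V \<noteq> {}" using s0 V by auto
  have "\<exists>R \<in> \<rho> ` walks b. 2 ^ (M * b) < card {fs \<in> walks b. \<rho> fs = R}"
  proof (rule ccontr)
    assume "\<not> ?thesis"
    then have le: "card {fs \<in> walks b. \<rho> fs = R} \<le> 2 ^ (M * b)" if "R \<in> \<rho> ` walks b" for R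
      using that by (meson not_le)
    have "d ^ b \<le> card (walks b)" using card_walks[OF deg s0] by simp
    also have "walks b = (\<Union>R\<in>\<rho> ` walks b. {fs \<in> walks b. \<rho> fs = R})" by auto
    also have "card \<dots> \<le> (\<Sum>R\<in>\<rho> ` walks b. card {fs \<in> walks b. \<rho> fs = R})"
      by (rule card_UN_le) (simp add: finite_walks)
    also have "\<dots> \<le> (\<Sum>R\<in>\<rho> ` walks b. 2 ^ (M * b))" by (rule sum_mono) (rule le)
    also have "\<dots> = card (\<rho> ` walks b) * 2 ^ (M * b)" by simp
    finally have "d ^ b * card V ^ (K * P - 1) \<le> 2 ^ (M * b) * (card (\<rho> ` walks b) * card V ^ (K * P - 1))"
      by (simp add: ac_simps)
    also have "\<dots> \<le> 2 ^ (M * b) * card V ^ (b * (r - 1 - q))"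
      using card_root_maps[OF V V0] unfolding \<rho>_def by (intro mult_le_mono2)
    finally show False using big by simp
  qed
  \<comment> \<open>Many walks share their roots; a maximal dense set containing these roots cannot be small.\<close>
  then obtain fs0 where fs0: "fs0 \<in> walks b" and
    many: "2 ^ (M * b) < card {fs \<in> walks b. \<rho> fs = \<rho> fs0}" by auto
  define \<Phi> where "\<Phi> = {fs \<in> walks b. \<rho> fs = \<rho> fs0}"
  define U0 where "U0 = insert s0 (\<Union>i<b. roots fs0 i)"
  have roots_eq: "roots fs i = roots fs0 i" if "fs \<in> \<Phi>" "i < b" for fs i
  proof -
    have "\<rho> fs i = \<rho> fs0 i" using that by (simp add: \<Phi>_def)
    then show ?thesis using that by (simp add: \<rho>_def)
  qed
  have rsub: "roots fs0 i \<subseteq> fs0 ! i \<and> fs0 ! i \<in> E" if "i < b" for i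
  proof -
    have e: "fs0 ! i \<in> E" "sp fs0 i \<in> fs0 ! i" using that fs0 by (auto simp: walks_def)
    then show ?thesis using Rt[OF e] nx[OF e] by (auto simp: roots_def)
  qed
  have U0V: "U0 \<subseteq> V" using rsub s0 V by (fastforce simp: U0_def)
  have "card U0 \<le> Suc (card (\<Union>i<b. roots fs0 i))" unfolding U0_def by (rule card_insert_le_m1) simp_all
  also have "card (\<Union>i<b. roots fs0 i) \<le> (\<Sum>i<b. card (roots fs0 i))" by (rule card_UN_le) simp
  also have "\<dots> \<le> (\<Sum>i<b. r)" using rsub card_edge by (intro sum_mono) (metis card_mono lessThan_iff)
  finally have cU0: "card U0 \<le> 1 + b * r" by simp
  \<comment> \<open>The slack \<open>Q * (1 + b * r)\<close> makes \<open>U0\<close> good even if it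
    spans no edge.\<close>
  define good where "good U \<longleftrightarrow> U0 \<subseteq> U \<and> U \<subseteq> V \<and> card U \<le> M \<and>
     Q * card U \<le> (Q * q + P) * card {e \<in> E. e \<subseteq> U} + Q * (1 + b * r)" for U
  have "Q * card U0 \<le> Q * (1 + b * r)" using cU0 by (rule mult_le_mono2)
  then have "good U0" using U0V cU0 M unfolding good_def by (intro conjI trans_le_add2) auto
  \<comment> \<open>A good set of maximal size takes the place of an iteration that adds walks one
    at a time.\<close>
  have "\<exists>U. good U \<and> (\<forall>U'. good U' \<longrightarrow> card U' \<le> card U)"
    using \<open>good U0\<close> by (intro ex_has_greatest_nat[of good U0 card "Suc (card V)"])
      (auto simp: good_def less_Suc_eq_le intro: card_mono[OF V(1)])
  then obtain U where U: "good U" and max: "\<And>U'. good U' \<Longrightarrow> card U' \<le> card U" by blast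
  have finU: "finite U" using U V by (auto simp: good_def intro: finite_subset)
  have "M < card U + b * r"
  proof (rule ccontr)
    assume small: "\<not> M < card U + b * r"
    \<comment> \<open>There are more walks with the common roots than lists of \<open>b\<close>
      subsets of \<open>U\<close>, so one of these walks leaves \<open>U\<close>.\<close>
    have "\<not> \<Phi> \<subseteq> {fs. set fs \<subseteq> Pow U \<and> length fs = b}"
    proof
      assume "\<Phi> \<subseteq> {fs. set fs \<subseteq> Pow U \<and> length fs = b}"
      then have "card \<Phi> \<le> card {fs. set fs \<subseteq> Pow U \<and> length fs = b}"
        using finU by (intro card_mono finite_lists_length_eq) auto
      also have "\<dots> = 2 ^ (card U * b)" using finU
        by (simp add: card_lists_length_eq card_Pow power_mult)
      also have "\<dots> \<le> 2 ^ (M * b)" using U by (intro power_increasing) (auto simp: good_def)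
      finally show False using many by (simp add: \<Phi>_def)
    qed
    then obtain fs where fs: "fs \<in> \<Phi>" "\<not> set fs \<subseteq> Pow U" by (auto simp: \<Phi>_def walks_def)
    then have w: "fs \<in> walks b" by (simp add: \<Phi>_def)
    then have setfs: "set fs \<subseteq> E" "length fs = b" by (auto simp: walks_def)
    define W where "W = \<Union>(set fs) - U"
    have finW: "finite W" using setfs V by (auto simp: W_def intro: finite_subset)
    have "W \<noteq> {}" using fs by (auto simp: W_def)
    then have W1: "card W \<ge> 1" using finW by (simp add: Suc_leI card_gt_0_iff)
    have "card W \<le> card (\<Union>(set fs))" using setfs V by (intro card_mono) (auto simp: W_def intro: finite_subset)
    also have "\<dots> \<le> (\<Sum>e\<in>set fs. card e)" by (rule card_Union_le_sum_card)
    also have "\<dots> \<le> (\<Sum>e\<in>set fs. r)" using setfs card_edge by (intro sum_mono) auto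
    also have "\<dots> \<le> b * r" using setfs card_length[of fs] by simp
    finally have W2: "card W \<le> b * r" .
    have g: "Q * card W \<le> (Q * q + P) * card {e \<in> set fs. e \<inter> W \<noteq> {}}"
      unfolding W_def
    proof (rule growth[OF w])
      show "s0 \<in> U" using U by (auto simp: good_def U0_def)
      show "roots fs i \<subseteq> U" if "i < b" for i
        using roots_eq[OF fs(1) that] U that by (auto simp: good_def U0_def)
    qed
    have cUW: "card (U \<union> W) = card U + card W" using finU finW by (intro card_Un_disjoint) (auto simp: W_def)
    \<comment> \<open>Edges meeting \<open>W\<close> are not contained in \<open>U\<close>, so they
      add to the edges already counted there; \<open>growth\<close> pays for the vertices of
      \<open>W\<close> with them.\<close>
    have "card {e \<in> E. e \<subseteq> U} + card {e \<in> set fs. e \<inter> W \<noteq> {}} =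
        card ({e \<in> E. e \<subseteq> U} \<union> {e \<in> set fs. e \<inter> W \<noteq> {}})"
      using finE by (intro card_Un_disjoint[symmetric]) (auto simp: W_def)
    also have "\<dots> \<le> card {e \<in> E. e \<subseteq> U \<union> W}"
      using finE setfs by (intro card_mono) (auto simp: W_def)
    finally have ce: "card {e \<in> E. e \<subseteq> U} + card {e \<in> set fs. e \<inter> W \<noteq> {}} \<le> card {e \<in> E. e \<subseteq> U \<union> W}" .
    have "Q * card (U \<union> W) = Q * card U + Q * card W" by (simp add: cUW algebra_simps)
    also have "\<dots> \<le> (Q * q + P) * (card {e \<in> E. e \<subseteq> U} + card {e \<in> set fs. e \<inter> W \<noteq> {}}) + Q * (1 + b * r)"
      using g U unfolding good_def distrib_left by linarith
    also have "\<dots> \<le> (Q * q + P) * card {e \<in> E. e \<subseteq> U \<union> W} + Q * (1 + b * r)"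
      using ce by (intro add_right_mono mult_le_mono2)
    finally have "good (U \<union> W)" using U setfs V small W2 cUW by (auto simp: good_def W_def)
    from max[OF this] show False using cUW W1 by simp
  qed
  then show ?thesis using U by (auto simp: good_def)
qed

end

section \<open>Dense set systems have small dense subsets\<close>

text \<open>Deleting a vertex of degree below \<open>D\<close> loses fewer than \<open>D\<close>
  edges, while \<open>D * card V\<close> drops by exactly \<open>D\<close>. The inequality survives
  and becomes strict, so edges always remain.\<close>

lemma min_degree_subset:
  fixes E :: "'a set set"
  assumes "finite V" "E \<subseteq> Pow V" "D * card V \<le> card E" "E \<noteq> {}"
  shows "\<exists>E' \<subseteq> E. E' \<noteq> {} \<and> (\<forall>v \<in> \<Union>E'. D \<le> card {e \<in> E'. v \<in> e})"
  using assms
proof (induction "card V" arbitrary: V E rule: less_induct)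
  case less
  show ?case
  proof (cases "\<forall>v \<in> \<Union>E. D \<le> card {e \<in> E. v \<in> e}")
    case True
    then show ?thesis using less.prems by blast
  next
    case False
    then obtain v where v: "v \<in> \<Union>E" "card {e \<in> E. v \<in> e} < D" by force
    then have vV: "v \<in> V" using less.prems by auto
    have finE: "finite E" using less.prems by (intro finite_subset[of E "Pow V"]) auto
    define E1 where "E1 = {e \<in> E. v \<notin> e}"
    have "card E = card E1 + card {e \<in> E. v \<in> e}"
      unfolding E1_def card_Int_Diff[OF finE, of "{e. v \<in> e}"]
      by (simp add: Int_def set_diff_eq)
    moreover have "card V = Suc (card (V - {v}))" using vV less.prems(1) by (rule card.remove[rotated])
    then have "D * card V = D + D * card (V - {v})" by (simp only: mult_Suc_right)
    ultimately have c: "D * card (V - {v}) < card E1" using less.prems(3) v(2) by linarith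
    then have "E1 \<noteq> {}" by auto
    have less': "card (V - {v}) < card V" using less.prems(1) vV by (rule card_Diff1_less)
    have E1V: "E1 \<subseteq> Pow (V - {v})" using less.prems(2) by (auto simp: E1_def)
    have "finite (V - {v})" using less.prems(1) by simp
    note less.hyps[OF less' this E1V less_imp_le[OF c] \<open>E1 \<noteq> {}\<close>]
    moreover have "E1 \<subseteq> E" by (auto simp: E1_def)
    ultimately show ?thesis by (meson subset_trans)
  qed
qed

text \<open>The caterpillar argument is run inside a subsystem of minimum degree at least
  \<open>d + Q * K\<close>; edges found there are edges of \<open>E\<close>.\<close>

lemma dense_subset:
  fixes E :: "'a set set"
  assumes V: "finite V" and E: "E \<subseteq> {e. e \<subseteq> V \<and> card e = r}" "E \<noteq> {}"
    and q: "q + 2 \<le> r" and P: "0 < P" "P < Q"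
    and deg: "(d + Q * K) * card V \<le> card E"
    and M: "1 + Q * K * r \<le> M"
    and big: "2 ^ (M * (Q * K)) * card V ^ (Q * K * (r - 1 - q)) < d ^ (Q * K) * card V ^ (K * P - 1)"
  shows "\<exists>U \<subseteq> V. card U \<le> M \<and> M < card U + Q * K * r \<and>
           Q * card U \<le> (Q * q + P) * card {e \<in> E. e \<subseteq> U} + Q * (1 + Q * K * r)"
proof -
  have "E \<subseteq> Pow V" using E by auto
  obtain E' where E': "E' \<subseteq> E" "E' \<noteq> {}"
    and deg': "\<And>v. v \<in> \<Union>E' \<Longrightarrow> d + Q * K \<le> card {e \<in> E'. v \<in> e}"
    using min_degree_subset[OF V \<open>E \<subseteq> Pow V\<close> deg E(2)] by blast
  have finE0: "finite E" using V by (intro finite_subset[OF \<open>E \<subseteq> Pow V\<close>]) simp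
  \<comment> \<open>Any choice of next vertex and of roots satisfies the locale assumptions;
    \<open>q + 2 \<le> r\<close> leaves enough vertices in each edge.\<close>
  define nx where "nx = (\<lambda>v e :: 'a set. SOME w. w \<in> e - {v})"
  define Rt where "Rt = (\<lambda>v e. SOME A. A \<subseteq> e - {v, nx v e} \<and> card A = r - 2 - q)"
  have edge: "finite e" "card e = r" if "e \<in> E'" for e
    using that E E' finite_subset[OF _ V, of e] by auto
  have nx: "nx v e \<in> e - {v}" if "e \<in> E'" "v \<in> e" for e v
  proof -
    have "card (e - {v}) \<noteq> 0" using edge[OF that(1)] that(2) q by simp
    then have "\<exists>w. w \<in> e - {v}" by (metis card.empty ex_in_conv)
    then show ?thesis unfolding nx_def by (rule someI_ex)
  qed
  have Rt: "Rt v e \<subseteq> e - {v, nx v e} \<and> card (Rt v e) = r - 2 - q" if "e \<in> E'" "v \<in> e" for e v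
  proof -
    have "card (e - {v, nx v e}) = r - 2"
      using edge[OF that(1)] that(2) nx[OF that] by (subst card_Diff_subset) auto
    then have "\<exists>A. A \<subseteq> e - {v, nx v e} \<and> card A = r - 2 - q"
      using obtain_subset_with_card_n[of "r - 2 - q" "e - {v, nx v e}"] by (metis diff_le_self)
    then show ?thesis unfolding Rt_def by (rule someI_ex)
  qed
  obtain s0 where s0: "s0 \<in> \<Union>E'"
  proof -
    obtain e where e: "e \<in> E'" using E' by auto
    then have "e \<noteq> {}" using edge[OF e] q by auto
    then show ?thesis using e that by auto
  qed
  interpret caterpillar E' s0 nx Rt r q P Q K
    using finE0 E' edge nx Rt q P by unfold_locales (auto intro: finite_subset)
  have sub: "\<Union>E' \<subseteq> V" using E' E by auto
  obtain U where U: "U \<subseteq> V" "card U \<le> M" "M < card U + Q * K * r"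
      "Q * card U \<le> (Q * q + P) * card {e \<in> E'. e \<subseteq> U} + Q * (1 + Q * K * r)"
    using dense_set[OF V sub s0 deg' M big] by blast
  have "card {e \<in> E'. e \<subseteq> U} \<le> card {e \<in> E. e \<subseteq> U}"
    using finE0 E' by (intro card_mono) auto
  then have "(Q * q + P) * card {e \<in> E'. e \<subseteq> U} \<le> (Q * q + P) * card {e \<in> E. e \<subseteq> U}"
    by (rule mult_le_mono2)
  then have "Q * card U \<le> (Q * q + P) * card {e \<in> E. e \<subseteq> U} + Q * (1 + Q * K * r)"
    using U(4) by linarith
  with U(1-3) show ?thesis by blast
qed

lemma eventually_nat_powr_gt:
  assumes "a > 0"
  shows "\<forall>\<^sub>F n in sequentially. real n powr a > C"
proof -
  have "filterlim (\<lambda>n. exp (a * ln (real n))) at_top sequentially"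
    by (intro filterlim_compose[OF exp_at_top]
        filterlim_tendsto_pos_mult_at_top[OF tendsto_const assms]
        filterlim_compose[OF ln_at_top filterlim_real_sequentially])
  then have "\<forall>\<^sub>F n in sequentially. exp (a * ln (real n)) > C"
    by (simp add: filterlim_at_top_dense)
  then show ?thesis
    using eventually_gt_at_top[of 0] by eventually_elim (simp add: powr_def)
qed

lemma dense_subset_asymptotic:
  fixes \<rho> \<epsilon> :: real
  assumes \<rho>: "\<rho> > 0" "1 / \<rho> < real r - 1" and \<epsilon>: "\<epsilon> > 0"
  shows "\<exists>T>0. \<forall>\<^sub>F n in sequentially. \<forall>(V :: 'a set) E. finite V \<longrightarrow> card V = n \<longrightarrow>
           E \<subseteq> {e. e \<subseteq> V \<and> card e = r} \<longrightarrow> 1 / real r * real n powr (real r - 1 / \<rho> + \<epsilon>) \<le> real (card E) \<longrightarrow>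
           (\<exists>U \<subseteq> V. U \<noteq> {} \<and> card U \<le> T \<and> \<rho> * real (card U) \<le> real (card {e \<in> E. e \<subseteq> U}))"
proof -
  \<comment> \<open>The largest integer strictly below \<open>1 / \<rho>\<close>, so that a positive
    fraction \<theta> can be added without reaching \<open>1 / \<rho>\<close>.\<close>
  define q where "q = nat (\<lceil>1 / \<rho>\<rceil> - 1)"
  have "\<lceil>1 / \<rho>\<rceil> \<ge> 1" using \<rho> by simp
  then have q_real: "real q = of_int \<lceil>1 / \<rho>\<rceil> - 1" by (simp add: q_def)
  then have q1: "real q < 1 / \<rho>" "1 / \<rho> \<le> real q + 1" by linarith+
  then have "real q < real r - 1" using \<rho> by linarith
  then have qr: "q + 2 \<le> r" by linarith
  \<comment> \<open>Being strictly below \<open>1 / \<rho> - q\<close>, \<theta> gives more than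
    \<rho> edges per new vertex; being within \<epsilon>/2 of it, \<theta> keeps the walks more
    numerous than the choices of roots.\<close>
  obtain \<theta> where "\<theta> \<in> \<rat>" and \<theta>1: "max 0 (1 / \<rho> - real q - \<epsilon> / 2) < \<theta>" and \<theta>2: "\<theta> < 1 / \<rho> - real q"
    using Rats_dense_in_real[of "max 0 (1 / \<rho> - real q - \<epsilon> / 2)" "1 / \<rho> - real q"] q1 \<epsilon> by auto
  then have \<theta>0: "0 < \<theta>" "\<theta> < 1" "1 / \<rho> - real q - \<epsilon> / 2 < \<theta>" using q1 by auto
  obtain P Q where PQ: "Q \<noteq> 0" "\<theta> = real P / real Q"
    using Rats_abs_nat_div_natE[OF \<open>\<theta> \<in> \<rat>\<close>] \<theta>0 by (metis abs_of_pos)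
  have "real P = \<theta> * real Q" using PQ by simp
  moreover have "\<theta> * real Q < 1 * real Q" using PQ \<theta>0 by (intro mult_strict_right_mono) auto
  moreover have "0 < \<theta> * real Q" using PQ(1) \<theta>0(1) by (intro mult_pos_pos) auto
  ultimately have "0 < real P" "real P < real Q" by linarith+
  then have P: "0 < P" "P < Q" by simp_all
  \<comment> \<open>The gain in the exponent grows like \<open>b * \<epsilon> / 2\<close>; a large
    \<open>K\<close> lets it outweigh the one advance lost at the last edge.\<close>
  obtain K0 :: nat where K0: "4 / \<epsilon> < real K0" using reals_Archimedean2 by blast
  define K where "K = Suc K0"
  have K: "0 < K" "4 / \<epsilon> < real K" using K0 by (auto simp: K_def)
  define b where "b = Q * K"
  define \<gamma> where "\<gamma> = real r - 1 - 1 / \<rho> + \<epsilon>"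
  have \<gamma>0: "\<gamma> > 0" using \<rho> \<epsilon> by (simp add: \<gamma>_def)
  \<comment> \<open>Up to constants, \<open>n powr \<eta>\<close> walks share their roots.\<close>
  define \<eta> where "\<eta> = \<gamma> * real b + real (K * P - 1) - real (b * (r - 1 - q))"
  have "\<eta> > 0"
  proof -
    have "K * P \<ge> 1" using K P by (simp add: Suc_leI)
    then have "\<eta> = \<gamma> * real b + real K * real P - 1 - real b * (real r - 1 - real q)"
      using qr by (simp add: \<eta>_def of_nat_diff)
    also have "real K * real P = real b * \<theta>" using PQ by (simp add: b_def)
    finally have "\<eta> = real b * (\<epsilon> + \<theta> + real q - 1 / \<rho>) - 1" by (simp add: \<gamma>_def algebra_simps)
    moreover have "real b * (\<epsilon> / 2) \<le> real b * (\<epsilon> + \<theta> + real q - 1 / \<rho>)"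
      using \<theta>0 by (intro mult_left_mono) auto
    moreover have "2 < real b * (\<epsilon> / 2)"
    proof -
      have "4 < real K * \<epsilon>" using K \<epsilon> by (simp add: divide_simps)
      also have "\<dots> \<le> real b * \<epsilon>"
      proof (intro mult_right_mono)
        have "1 * K \<le> Q * K" using P by (intro mult_le_mono1) simp
        then show "real K \<le> real b" unfolding b_def of_nat_le_iff by simp
      qed (use \<epsilon> in simp)
      finally show ?thesis by simp
    qed
    ultimately show ?thesis by linarith
  qed
  \<comment> \<open>The relative margin by which the edge density of the caterpillar exceeds
    \<rho>.\<close>
  define \<delta> where "\<delta> = 1 - \<rho> * (real q + \<theta>)"
  have "\<rho> * (real q + \<theta>) < \<rho> * (1 / \<rho>)" using \<theta>2 \<rho> by (intro mult_strict_left_mono) auto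
  then have \<delta>0: "\<delta> > 0" using \<rho> by (simp add: \<delta>_def)
  \<comment> \<open>A set of more than \<open>L\<close> vertices has enough margin to absorb the
    additive term \<open>1 + b * r\<close>; \<open>M\<close> is chosen to force this size.\<close>
  obtain L :: nat where L: "real (1 + b * r) / \<delta> < real L" using reals_Archimedean2 by blast
  define M where "M = L + 1 + b * r"
  have r0: "real r > 0" using qr by simp
  have "\<forall>\<^sub>F n in sequentially. real n powr \<gamma> > 2 * real r * (real b + 1) \<and>
      real n powr \<eta> > 2 ^ (M * b) * (2 * real r) ^ b \<and> n > 0"
    using eventually_nat_powr_gt[OF \<gamma>0] eventually_nat_powr_gt[OF \<open>\<eta> > 0\<close>] eventually_gt_at_top[of 0]
    by (simp add: eventually_conj_iff)
  then have "\<forall>\<^sub>F n in sequentially. \<forall>(V :: 'a set) E. finite V \<longrightarrow> card V = n \<longrightarrow>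
           E \<subseteq> {e. e \<subseteq> V \<and> card e = r} \<longrightarrow> 1 / real r * real n powr (real r - 1 / \<rho> + \<epsilon>) \<le> real (card E) \<longrightarrow>
           (\<exists>U \<subseteq> V. U \<noteq> {} \<and> card U \<le> M \<and> \<rho> * real (card U) \<le> real (card {e \<in> E. e \<subseteq> U}))"
  proof (rule eventually_mono, intro allI impI)
    fix n and V :: "'a set" and E
    assume n: "real n powr \<gamma> > 2 * real r * (real b + 1) \<and> real n powr \<eta> > 2 ^ (M * b) * (2 * real r) ^ b \<and> n > 0"
      and V: "finite V" "card V = n" and E: "E \<subseteq> {e. e \<subseteq> V \<and> card e = r}"
      and many: "1 / real r * real n powr (real r - 1 / \<rho> + \<epsilon>) \<le> real (card E)"
    define g where "g = real n powr \<gamma> / real r"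
    have g: "g > 2 * (real b + 1)" using n r0 by (simp add: g_def pos_less_divide_eq algebra_simps)
    have gE: "g * real n \<le> real (card E)"
    proof -
      have "real n powr (real r - 1 / \<rho> + \<epsilon>) = real n powr (\<gamma> + 1)"
        by (rule arg_cong[where f = "(powr) (real n)"]) (simp add: \<gamma>_def)
      also have "\<dots> = real n powr \<gamma> * real n" using n by (simp add: powr_add)
      finally show ?thesis using many by (simp add: g_def)
    qed
    \<comment> \<open>Subtracting \<open>b\<close> reserves the edges already used by a walk. The
      first threshold on \<open>n\<close> still keeps \<open>d\<close> at least
      \<open>g / 2\<close>.\<close>
    define d where "d = nat \<lfloor>g\<rfloor> - b"
    have d: "real d + real b \<le> g" "g / 2 \<le> real d" using g by (auto simp: d_def of_nat_diff) linarith+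
    have "(real d + real b) * real n \<le> g * real n" using d by (intro mult_right_mono) auto
    then have "real ((d + b) * card V) \<le> real (card E)" using gE V by simp
    then have deg: "(d + Q * K) * card V \<le> card E" by (simp only: of_nat_le_iff b_def)
    have "g * real n > 0" using n g by simp
    then have "E \<noteq> {}" using gE by auto
    \<comment> \<open>The second threshold on \<open>n\<close> is this inequality with
      \<open>d\<close> replaced by its lower bound \<open>g / 2\<close>; both sides carry the factor
      \<open>(2 * real r) ^ b\<close> to clear the denominators.\<close>
    have big: "2 ^ (M * b) * n ^ (b * (r - 1 - q)) < d ^ b * n ^ (K * P - 1)"
    proof -
      have pw: "real n powr real k = real n ^ k" for k using n by (simp add: powr_realpow)
      have gr: "(real n powr \<gamma>) powr real b = (g * real r) ^ b"
        using n r0 by (subst powr_realpow) (auto simp: g_def)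
      have "real (2 ^ (M * b) * n ^ (b * (r - 1 - q))) * (2 * real r) ^ b
          = 2 ^ (M * b) * (2 * real r) ^ b * real n powr real (b * (r - 1 - q))"
        unfolding pw by simp
      also have "\<dots> < real n powr \<eta> * real n powr real (b * (r - 1 - q))"
        using n by (intro mult_strict_right_mono) auto
      also have "\<dots> = real n powr (\<gamma> * real b + real (K * P - 1))"
        by (simp add: powr_add[symmetric] \<eta>_def)
      also have "\<dots> = (g * real r) ^ b * real n ^ (K * P - 1)"
        unfolding powr_add powr_powr[symmetric] pw gr by simp
      also have "\<dots> = (g / 2) ^ b * real n ^ (K * P - 1) * (2 * real r) ^ b"
        by (simp add: power_mult_distrib power_divide)
      also have "\<dots> \<le> real d ^ b * real n ^ (K * P - 1) * (2 * real r) ^ b"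
        using d g r0 by (intro mult_right_mono power_mono) auto
      finally have "real (2 ^ (M * b) * n ^ (b * (r - 1 - q))) * (2 * real r) ^ b
          < real (d ^ b * n ^ (K * P - 1)) * (2 * real r) ^ b" by simp
      then show ?thesis using r0 by (simp only: mult_less_cancel_right of_nat_less_iff) auto
    qed
    obtain U where U: "U \<subseteq> V" "card U \<le> M" "M < card U + b * r"
      "Q * card U \<le> (Q * q + P) * card {e \<in> E. e \<subseteq> U} + Q * (1 + b * r)"
      using dense_subset[OF V(1) E \<open>E \<noteq> {}\<close> qr P deg, of M] big V
      by (auto simp: b_def M_def)
    define m where "m = card {e \<in> E. e \<subseteq> U}"
    have "real Q * real (card U) \<le> (real Q * real q + real P) * real m + real Q * real (1 + b * r)"
      using U(4) unfolding m_def[symmetric] by (metis of_nat_add of_nat_le_iff of_nat_mult)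
    also have "\<dots> = real Q * ((real q + \<theta>) * real m + real (1 + b * r))" using PQ by (simp add: algebra_simps)
    finally have cU: "real (card U) \<le> (real q + \<theta>) * real m + real (1 + b * r)" using PQ by simp
    have "L < card U" using U(3) by (simp add: M_def)
    then have "real (1 + b * r) / \<delta> < real (card U)" using L by linarith
    then have c: "real (1 + b * r) < \<delta> * real (card U)" using \<delta>0 by (simp add: divide_simps mult.commute)
    have "\<rho> * real (card U) \<le> real m"
    proof -
      have "(real q + \<theta>) * (\<rho> * real (card U)) = (1 - \<delta>) * real (card U)" by (simp add: \<delta>_def)
      also have "\<dots> \<le> (real q + \<theta>) * real m"
        using c cU by (simp add: algebra_simps)
      finally show ?thesis using \<theta>0 by simp
    qed
    then show "\<exists>U \<subseteq> V. U \<noteq> {} \<and> card U \<le> M \<and> \<rho> * real (card U) \<le> real (card {e \<in> E. e \<subseteq> U})"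
      using U \<open>L < card U\<close> by (intro exI[of _ U]) (auto simp: m_def)
  qed
  then show ?thesis by (intro exI[of _ M]) (simp add: M_def)
qed

section \<open>Locally sparse set systems\<close>

text \<open>The weights describe a random subset \<open>E\<close> of \<open>X\<close> that contains each element independently with
  probability \<open>p\<close>.\<close>

lemma sum_random_subset_weights:
  fixes p :: real
  assumes X: "finite X" and S: "S \<subseteq> X"
  shows "(\<Sum>E\<in>Pow X. p ^ card E * (1 - p) ^ card (X - E) * (if S \<subseteq> E then 1 else 0)) = p ^ card S"
proof -
  have "p ^ card S = (\<Prod>x\<in>S. p)" by simp
  \<comment> \<open>Expanding the product sums over the set \<open>E\<close> of elements that
    contribute \<open>p\<close>. The other summand vanishes on \<open>S\<close>, which removes every
    \<open>E\<close> not containing \<open>S\<close>.\<close>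
  also have "\<dots> = (\<Prod>x\<in>X. p + (if x \<in> S then 0 else 1 - p))"
    using X S by (intro prod.mono_neutral_cong_left) auto
  also have "\<dots> = (\<Sum>E\<in>Pow X. (\<Prod>x\<in>E. p) * (\<Prod>x\<in>X - E. if x \<in> S then 0 else 1 - p))"
    by (rule prod_add[OF X])
  also have "\<dots> = (\<Sum>E\<in>Pow X. p ^ card E * (1 - p) ^ card (X - E) * (if S \<subseteq> E then 1 else 0))"
  proof (intro sum.cong refl)
    fix E assume "E \<in> Pow X"
    have "(\<Prod>x\<in>X - E. if x \<in> S then 0 else 1 - p) = (1 - p) ^ card (X - E) * (if S \<subseteq> E then 1 else 0)"
    proof (cases "S \<subseteq> E")
      case True
      then have "(\<Prod>x\<in>X - E. if x \<in> S then 0 else 1 - p) = (\<Prod>x\<in>X - E. 1 - p)"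
        by (intro prod.cong) auto
      then show ?thesis using True by simp
    next
      case False
      then obtain x where "x \<in> S" "x \<in> X - E" using S by auto
      then have "(\<Prod>x\<in>X - E. if x \<in> S then 0 else 1 - p) = 0"
        using X by (intro prod_zero) auto
      then show ?thesis using False by simp
    qed
    then show "(\<Prod>x\<in>E. p) * (\<Prod>x\<in>X - E. if x \<in> S then 0 else 1 - p) =
        p ^ card E * (1 - p) ^ card (X - E) * (if S \<subseteq> E then 1 else 0)" by simp
  qed
  finally show ?thesis by simp
qed

text \<open>The left side of the bound is the expectation of \<open>card E\<close> minus the number
  of indices \<open>i\<close> with \<open>B i\<close> inside \<open>E\<close>. Some \<open>E\<close>
  does at least as well as the mean, and removing one element of each \<open>B i\<close> inside it
  destroys them all.\<close>

lemma deletion_method: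
  fixes p :: real
  assumes X: "finite X" and I: "finite I" and B: "\<And>i. i \<in> I \<Longrightarrow> B i \<subseteq> X \<and> B i \<noteq> {}" and p: "0 \<le> p" "p \<le> 1"
  shows "\<exists>E \<subseteq> X. (\<forall>i\<in>I. \<not> B i \<subseteq> E) \<and> p * real (card X) - (\<Sum>i\<in>I. p ^ card (B i)) \<le> real (card E)"
proof -
  define wt where "wt E = p ^ card E * (1 - p) ^ card (X - E)" for E
  define ind :: "'a set \<Rightarrow> 'a set \<Rightarrow> real" where "ind S E = (if S \<subseteq> E then 1 else 0)" for S E
  define val where "val E = (\<Sum>x\<in>X. ind {x} E) - (\<Sum>i\<in>I. ind (B i) E)" for E
  have wt0: "wt E \<ge> 0" for E using p by (simp add: wt_def)
  have ex: "(\<Sum>E\<in>Pow X. wt E * ind S E) = p ^ card S" if "S \<subseteq> X" for S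
    using sum_random_subset_weights[OF X that, of p] by (simp add: wt_def ind_def)
  have wt1: "(\<Sum>E\<in>Pow X. wt E) = 1" using ex[of "{}"] by (simp add: ind_def)
  have "Max (val ` Pow X) \<in> val ` Pow X" using X by (intro Max_in) auto
  then obtain E0 where E0: "E0 \<in> Pow X" "val E0 = Max (val ` Pow X)" by (metis imageE)
  have max: "val E \<le> val E0" if "E \<in> Pow X" for E
    unfolding E0(2) using X that by (intro Max_ge) auto
  have "p * real (card X) - (\<Sum>i\<in>I. p ^ card (B i)) =
      (\<Sum>x\<in>X. \<Sum>E\<in>Pow X. wt E * ind {x} E) - (\<Sum>i\<in>I. \<Sum>E\<in>Pow X. wt E * ind (B i) E)"
  proof -
    have "(\<Sum>x\<in>X. \<Sum>E\<in>Pow X. wt E * ind {x} E) = (\<Sum>x\<in>X. p)"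
      by (intro sum.cong refl, subst ex) auto
    moreover have "(\<Sum>i\<in>I. \<Sum>E\<in>Pow X. wt E * ind (B i) E) = (\<Sum>i\<in>I. p ^ card (B i))"
      using B by (intro sum.cong refl ex) auto
    ultimately show ?thesis by (simp add: mult.commute)
  qed
  also have "\<dots> = (\<Sum>E\<in>Pow X. \<Sum>x\<in>X. wt E * ind {x} E) - (\<Sum>E\<in>Pow X. \<Sum>i\<in>I. wt E * ind (B i) E)"
    by (intro arg_cong2[where f = "(-)"] sum.swap)
  also have "\<dots> = (\<Sum>E\<in>Pow X. wt E * val E)"
    by (simp add: val_def sum_subtractf sum_distrib_left right_diff_distrib)
  also have "\<dots> \<le> (\<Sum>E\<in>Pow X. wt E * val E0)"
    using max wt0 by (intro sum_mono mult_left_mono)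
  also have "\<dots> = val E0" by (simp add: sum_distrib_right[symmetric] wt1)
  finally have v: "p * real (card X) - (\<Sum>i\<in>I. p ^ card (B i)) \<le> val E0" .
  define pick where "pick i = (SOME x. x \<in> B i)" for i
  have pick: "pick i \<in> B i" if "i \<in> I" for i
    unfolding pick_def using B[OF that] by (simp add: some_in_eq)
  define J where "J = {i\<in>I. B i \<subseteq> E0}"
  have finE0: "finite E0" using E0(1) X by (auto intro: finite_subset)
  have "(\<Sum>x\<in>X. ind {x} E0) = real (card E0)"
    using E0(1) X by (simp add: ind_def sum.If_cases Int_absorb1)
  moreover have "(\<Sum>i\<in>I. ind (B i) E0) = real (card J)"
    using I by (simp add: ind_def sum.If_cases J_def Int_def)
  moreover have "card (pick ` J) \<le> card J" using I by (intro card_image_le) (simp add: J_def)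
  moreover have "card E0 - card (pick ` J) \<le> card (E0 - pick ` J)"
    using I by (intro diff_card_le_card_Diff) (simp add: J_def)
  ultimately have "val E0 \<le> real (card (E0 - pick ` J))" unfolding val_def by linarith
  moreover have "\<not> B i \<subseteq> E0 - pick ` J" if i: "i \<in> I" for i
  proof
    assume sub: "B i \<subseteq> E0 - pick ` J"
    then have "i \<in> J" using i by (auto simp: J_def)
    then show False using sub pick[OF i] by blast
  qed
  ultimately show ?thesis using v E0(1) by (intro exI[of _ "E0 - pick ` J"]) auto
qed

lemma sparse_set_system:
  fixes \<rho> :: real
  assumes \<rho>: "\<rho> > 0" and r: "r > 0" and pos: "real r - 1 / \<rho> > 0"
  shows "\<forall>\<^sub>F n in sequentially. \<exists>E \<subseteq> {e. e \<subseteq> {..<n} \<and> card e = r}.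
           (\<forall>U \<subseteq> {..<n}. U \<noteq> {} \<longrightarrow> card U \<le> t \<longrightarrow> real (card {e \<in> E. e \<subseteq> U}) < \<rho> * real (card U)) \<and>
           1 / real r * real n powr (real r - 1 / \<rho>) \<le> real (card E)"
proof -
  \<comment> \<open>As \<open>n choose r\<close> is at least \<open>(n / r) ^ r\<close>, this
    constant makes the expected number of edges at least twice
    \<open>n powr (r - 1 / \<rho>)\<close>; one half pays for the deletions.\<close>
  define C where "C = 2 * real r ^ r"
  have "real r ^ r \<ge> 1" using r by simp
  then have C1: "C \<ge> 1" by (simp add: C_def)
  \<comment> \<open>The first factor bounds the number of set systems on at most \<open>t\<close>
    vertices, the second the contribution of \<open>C\<close> to the probability of a bad
    one.\<close>
  define A where "A = 2 ^ (2 ^ t) * C powr (\<rho> * real t)"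
  have "\<forall>\<^sub>F n in sequentially. real n powr (1 / \<rho>) > C \<and> real n powr (real r - 1 / \<rho>) > real t * A \<and> n \<ge> r"
    using \<rho> pos by (intro eventually_conj eventually_nat_powr_gt eventually_ge_at_top) auto
  then show ?thesis
  proof (rule eventually_mono)
    \<comment> \<open>The three conditions yield, in turn, \<open>p \<le> 1\<close>, the payment for
      the deletions, and the lower bound for \<open>n choose r\<close>.\<close>
    fix n assume n: "real n powr (1 / \<rho>) > C \<and> real n powr (real r - 1 / \<rho>) > real t * A \<and> n \<ge> r"
    then have n0: "n > 0" using r by simp
    define p where "p = C * real n powr (- 1 / \<rho>)"
    have p0: "p > 0" using n0 C1 by (simp add: p_def)
    have p1: "p \<le> 1"
      using n n0 by (simp add: p_def powr_minus divide_simps powr_minus_divide)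
    define X where "X = {e. e \<subseteq> {..<n} \<and> card e = r}"
    define sets where "sets v = {U. U \<subseteq> {..<n} \<and> card U = v}" for v
    \<comment> \<open>Every sufficiently large system on \<open>U\<close> counts as bad, so that the
      edges of \<open>E\<close> inside a dense \<open>U\<close> themselves form a forbidden
      system.\<close>
    define bad where "bad U = {S. S \<subseteq> {e. e \<subseteq> U \<and> card e = r} \<and> \<rho> * real (card U) \<le> real (card S)}" for U :: "nat set"
    define I where "I = (SIGMA v:{1..t}. SIGMA U:sets v. bad U)"
    have finX: "finite X" by (simp add: X_def)
    have cX: "card X = n choose r" by (simp add: X_def n_subsets)
    have fins: "finite (sets v)" and cs: "card (sets v) = n choose v" for v
      by (simp_all add: sets_def n_subsets)
    have finU: "finite U" if "U \<in> sets v" for U v using that by (auto simp: sets_def intro: finite_subset)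
    have bad_sub: "bad U \<subseteq> Pow (Pow U)" for U by (auto simp: bad_def)
    have finb: "finite (bad U)" if "finite U" for U
      using that by (intro finite_subset[OF bad_sub]) simp
    have finI: "finite I" unfolding I_def using fins finb finU by (intro finite_SigmaI) auto
    \<comment> \<open>A bad system on \<open>v\<close> vertices survives with probability \<open>p powr (\<rho> * v) = O(n powr (- v))\<close> at most,
      which the number of vertex sets of size \<open>v\<close> cancels: only \<open>O(1)\<close> bad systems are expected.\<close>
    have sum_bad: "(\<Sum>S\<in>bad U. p ^ card S) \<le> A / real n ^ v" if "U \<in> sets v" "v \<le> t" for U v
    proof -
      have cU: "card U = v" using that by (simp add: sets_def)
      have "p ^ card S \<le> C powr (\<rho> * real t) / real n ^ v" if "S \<in> bad U" for S
      proof -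
        have "p ^ card S = p powr real (card S)" using p0 by (simp add: powr_realpow)
        also have "\<dots> \<le> p powr (\<rho> * real v)"
          using that p0 p1 cU by (intro powr_mono') (auto simp: bad_def)
        also have "\<dots> = C powr (\<rho> * real v) * (real n powr (- 1 / \<rho>)) powr (\<rho> * real v)"
          unfolding p_def using C1 by (simp add: powr_mult)
        also have "(real n powr (- 1 / \<rho>)) powr (\<rho> * real v) = real n powr (- real v)"
          using \<rho> by (simp add: powr_powr)
        also have "\<dots> = 1 / real n ^ v" using n0 by (simp add: powr_minus powr_realpow divide_inverse)
        also have "C powr (\<rho> * real v) \<le> C powr (\<rho> * real t)"
          using C1 \<rho> \<open>v \<le> t\<close> by (intro powr_mono mult_left_mono) auto
        finally show ?thesis by (simp add: mult_right_mono divide_right_mono)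
      qed
      then have "(\<Sum>S\<in>bad U. p ^ card S) \<le> real (card (bad U)) * (C powr (\<rho> * real t) / real n ^ v)"
        by (rule sum_bounded_above)
      also have "card (bad U) \<le> 2 ^ (2 ^ t)"
      proof -
        have "card (bad U) \<le> card (Pow (Pow U))"
          using finU[OF that(1)] by (intro card_mono bad_sub) simp
        also have "\<dots> = 2 ^ (2 ^ v)" using finU[OF that(1)] cU by (simp add: card_Pow)
        also have "\<dots> \<le> 2 ^ (2 ^ t)" using that by (intro power_increasing) auto
        finally show ?thesis .
      qed
      then have "real (card (bad U)) * (C powr (\<rho> * real t) / real n ^ v)
          \<le> 2 ^ (2 ^ t) * (C powr (\<rho> * real t) / real n ^ v)"
        by (intro mult_right_mono) (simp_all add: numeral_power_le_of_nat_cancel_iff of_nat_le_numeral_power_cancel_iff)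
      finally show ?thesis by (simp add: A_def)
    qed
    have A0: "A \<ge> 0" by (simp add: A_def)
    have finSig: "finite (Sigma (sets v) bad)" for v using fins finb finU by (intro finite_SigmaI) auto
    have "(\<Sum>(v, U, S)\<in>I. p ^ card S) = (\<Sum>v\<in>{1..t}. \<Sum>(U, S)\<in>Sigma (sets v) bad. p ^ card S)"
      unfolding I_def by (rule sum.Sigma[symmetric]) (simp_all add: finSig)
    also have "\<dots> = (\<Sum>v\<in>{1..t}. \<Sum>U\<in>sets v. \<Sum>S\<in>bad U. p ^ card S)"
      using fins finb finU by (intro sum.cong refl sum.Sigma[symmetric]) auto
    also have "\<dots> \<le> (\<Sum>v\<in>{1..t}. A)"
    proof (rule sum_mono)
      fix v assume v: "v \<in> {1..t}"
      have "(\<Sum>U\<in>sets v. \<Sum>S\<in>bad U. p ^ card S) \<le> real (card (sets v)) * (A / real n ^ v)"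
        using sum_bad v by (intro sum_bounded_above) auto
      also have "\<dots> \<le> real (n ^ v) * (A / real n ^ v)"
        using A0 choose_le_power[of n v] unfolding cs by (intro mult_right_mono of_nat_mono) auto
      also have "\<dots> = A" using n0 by simp
      finally show "(\<Sum>U\<in>sets v. \<Sum>S\<in>bad U. p ^ card S) \<le> A" .
    qed
    also have "\<dots> = real t * A" by simp
    finally have cost: "(\<Sum>i\<in>I. p ^ card (snd (snd i))) \<le> real t * A" by (simp add: split_def)
    have B: "snd (snd i) \<subseteq> X \<and> snd (snd i) \<noteq> {}" if "i \<in> I" for i
    proof -
      obtain v U S where i: "i = (v, U, S)" by (cases i)
      have "1 \<le> v" "U \<subseteq> {..<n}" "card U = v" "S \<subseteq> {e. e \<subseteq> U \<and> card e = r}" "\<rho> * real (card U) \<le> real (card S)"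
        using that by (auto simp: i I_def sets_def bad_def)
      moreover have "0 < \<rho> * real (card U)" using \<rho> calculation by simp
      ultimately show ?thesis by (auto simp: i X_def)
    qed
    have "\<exists>E \<subseteq> X. (\<forall>i\<in>I. \<not> snd (snd i) \<subseteq> E) \<and>
        p * real (card X) - (\<Sum>i\<in>I. p ^ card (snd (snd i))) \<le> real (card E)"
      by (rule deletion_method[where B = "\<lambda>i. snd (snd i)"])
        (fact finX finI less_imp_le[OF p0] p1 B)+
    then obtain E where E: "E \<subseteq> X" "\<And>i. i \<in> I \<Longrightarrow> \<not> snd (snd i) \<subseteq> E"
      "p * real (card X) - (\<Sum>i\<in>I. p ^ card (snd (snd i))) \<le> real (card E)"
      by blast
    have "2 * real n powr (real r - 1 / \<rho>) = C * real n powr (- 1 / \<rho>) * (real n / real r) ^ r"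
    proof -
      have "real n powr (real r - 1 / \<rho>) = real n powr (- 1 / \<rho>) * real n ^ r"
        using n0 by (simp add: powr_realpow[symmetric] powr_add[symmetric])
      then show ?thesis using r by (simp add: C_def power_divide)
    qed
    also have "\<dots> \<le> p * real (card X)"
      unfolding p_def[symmetric] cX using p0 binomial_ge_n_over_k_pow_k[of r n, where 'a = real] n by (intro mult_left_mono) auto
    finally have "real n powr (real r - 1 / \<rho>) \<le> real (card E)" using E(3) cost n by linarith
    moreover have "1 / real r * real n powr (real r - 1 / \<rho>) \<le> 1 * real n powr (real r - 1 / \<rho>)"
      using r by (intro mult_right_mono) auto
    ultimately have many: "1 / real r * real n powr (real r - 1 / \<rho>) \<le> real (card E)" by linarith
    have "real (card {e \<in> E. e \<subseteq> U}) < \<rho> * real (card U)"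
      if U: "U \<subseteq> {..<n}" "U \<noteq> {}" "card U \<le> t" for U
    proof (rule ccontr)
      assume "\<not> ?thesis"
      then have "{e \<in> E. e \<subseteq> U} \<in> bad U" using E(1) by (auto simp: bad_def X_def)
      moreover have "finite U" using U(1) by (rule finite_subset) simp
      then have "card U \<ge> 1" using U(2) by (simp add: Suc_leI card_gt_0_iff)
      ultimately have "(card U, U, {e \<in> E. e \<subseteq> U}) \<in> I" using U by (simp add: I_def sets_def)
      from E(2)[OF this] show False by simp
    qed
    then show "\<exists>E \<subseteq> {e. e \<subseteq> {..<n} \<and> card e = r}.
           (\<forall>U \<subseteq> {..<n}. U \<noteq> {} \<longrightarrow> card U \<le> t \<longrightarrow> real (card {e \<in> E. e \<subseteq> U}) < \<rho> * real (card U)) \<and>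
           1 / real r * real n powr (real r - 1 / \<rho>) \<le> real (card E)"
      using E(1) many unfolding X_def by blast
  qed
qed

section \<open>Extremal numbers\<close>

text \<open>Freeness from \<open>dense_family r s t\<close> without reference to isomorphism: among
  the subhypergraphs on a given vertex set the induced one is densest, so testing it
  suffices.\<close>

definition locally_sparse :: "nat \<Rightarrow> real \<Rightarrow> nat \<Rightarrow> 'a hypergraph \<Rightarrow> bool" where
  "locally_sparse r s t H \<longleftrightarrow> (\<forall>U \<subseteq> verts H. U \<noteq> {} \<longrightarrow> card U \<le> t \<longrightarrow>
     real (card {e \<in> hedges H. e \<subseteq> U}) < s / real r * real (card U))"

lemma avg_degree_ge_iff:
  assumes "r > 0" "card (verts H) > 0"
  shows "s \<le> avg_degree r H \<longleftrightarrow> s / real r * real (card (verts H)) \<le> real (card (hedges H))"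
  using assms by (simp add: avg_degree_def pos_le_divide_eq pos_divide_le_eq mult.commute)

text \<open>A dense set \<open>U\<close> induces a member of the family. Conversely, a copy of a
  member has the same numbers of vertices and edges, and all its edges are among those induced on
  its vertex set.\<close>

lemma dense_family_free_iff:
  fixes H :: "nat hypergraph"
  assumes H: "rgraph r H" and r: "r > 0"
  shows "(\<forall>F\<in>dense_family r s t. \<not> contains_copy H F) \<longleftrightarrow> locally_sparse r s t H"
proof
  assume free: "\<forall>F\<in>dense_family r s t. \<not> contains_copy H F"
  show "locally_sparse r s t H"
    unfolding locally_sparse_def
  proof (intro allI impI, rule ccontr)
    fix U assume U: "U \<subseteq> verts H" "U \<noteq> {}" "card U \<le> t"
      and dense: "\<not> real (card {e \<in> hedges H. e \<subseteq> U}) < s / real r * real (card U)"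
    define F where "F = (U, {e \<in> hedges H. e \<subseteq> U})"
    have finU: "finite U" using finite_subset[OF U(1)] H by (simp add: rgraph_def)
    have "rgraph r F" using H finU by (auto simp: rgraph_def F_def)
    moreover have "s \<le> avg_degree r F"
      using avg_degree_ge_iff[OF r, of F s] finU U(2) dense by (simp add: F_def card_gt_0_iff)
    ultimately have "F \<in> dense_family r s t" using U by (simp add: dense_family_def F_def)
    moreover have "hypergraph_iso F F" unfolding hypergraph_iso_def by (intro exI[of _ id]) simp
    moreover have "subhypergraph F H" using U(1) by (auto simp: subhypergraph_def F_def)
    ultimately have "F \<in> dense_family r s t" "contains_copy H F" unfolding contains_copy_def by blast+
    then show False using free by blast
  qed
next
  assume sparse: "locally_sparse r s t H"
  show "\<forall>F\<in>dense_family r s t. \<not> contains_copy H F"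
  proof (intro ballI notI)
    fix F assume F: "F \<in> dense_family r s t" and "contains_copy H F"
    then obtain F' f where F': "verts F' \<subseteq> verts H" "hedges F' \<subseteq> hedges H"
      and f: "bij_betw f (verts F) (verts F')" "(\<lambda>e. f ` e) ` hedges F = hedges F'"
      by (auto simp: contains_copy_def subhypergraph_def hypergraph_iso_def)
    have F_props: "finite (verts F)" "hedges F \<subseteq> Pow (verts F)" "verts F \<noteq> {}" "card (verts F) \<le> t" "s \<le> avg_degree r F"
      using F by (auto simp: dense_family_def rgraph_def)
    have cv: "card (verts F') = card (verts F)" using f(1) by (simp add: bij_betw_same_card)
    have "inj_on (\<lambda>e. f ` e) (Pow (verts F))"
      using f(1) by (intro inj_on_image_Pow) (auto simp: bij_betw_def)
    then have "inj_on (\<lambda>e. f ` e) (hedges F)" using F_props(2) by (rule inj_on_subset)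
    then have ce: "card (hedges F') = card (hedges F)" using f(2) by (metis card_image)
    have "f ` e \<subseteq> verts F'" if "e \<in> hedges F" for e
      using that F_props(2) f(1) by (auto simp: bij_betw_def)
    then have "hedges F' \<subseteq> {e \<in> hedges H. e \<subseteq> verts F'}"
      using F'(2) unfolding f(2)[symmetric] by (simp add: image_subset_iff)
    moreover have "finite (hedges H)" using H by (auto simp: rgraph_def intro: finite_subset[of _ "Pow (verts H)"])
    ultimately have "card (hedges F) \<le> card {e \<in> hedges H. e \<subseteq> verts F'}"
      unfolding ce[symmetric] by (intro card_mono) auto
    moreover have "s / real r * real (card (verts F)) \<le> real (card (hedges F))"
      using avg_degree_ge_iff[OF r, of F s] F_props by (simp add: card_gt_0_iff)
    moreover have "verts F' \<noteq> {}" using f(1) F_props(3) by (auto simp: bij_betw_def)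
    then have "real (card {e \<in> hedges H. e \<subseteq> verts F'}) < s / real r * real (card (verts F'))"
      using sparse F'(1) F_props(4) unfolding locally_sparse_def cv[symmetric] by blast
    ultimately show False using cv by simp
  qed
qed

lemma ex_number_eq:
  assumes "r > 0"
  shows "ex_number r n (dense_family r s t) =
    Max {card (hedges H) | H :: nat hypergraph. rgraph r H \<and> card (verts H) = n \<and> locally_sparse r s t H}"
  unfolding ex_number_def using dense_family_free_iff[OF _ assms, of _ s t]
  by (intro arg_cong[where f = Max] Collect_cong ex_cong1) blast

lemma finite_ex_number_values:
  "finite {card (hedges H) | H :: nat hypergraph. rgraph r H \<and> card (verts H) = n \<and> locally_sparse r s t H}"
proof (rule finite_subset)
  show "{card (hedges H) | H :: nat hypergraph. rgraph r H \<and> card (verts H) = n \<and> locally_sparse r s t H} \<subseteq> {..n choose r}"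
  proof
    fix m assume "m \<in> {card (hedges H) | H :: nat hypergraph. rgraph r H \<and> card (verts H) = n \<and> locally_sparse r s t H}"
    then obtain H :: "nat hypergraph" where H: "m = card (hedges H)" "rgraph r H" "card (verts H) = n" by blast
    then have "card (hedges H) \<le> card {e. e \<subseteq> verts H \<and> card e = r}"
      by (intro card_mono) (auto simp: rgraph_def)
    also have "\<dots> = n choose r" using H by (simp add: n_subsets rgraph_def)
    finally show "m \<in> {..n choose r}" using H(1) by simp
  qed
qed simp

lemma ex_number_attained:
  assumes "r > 0" "s > 0"
  shows "\<exists>H :: nat hypergraph. rgraph r H \<and> card (verts H) = n \<and> locally_sparse r s t H \<and>
           card (hedges H) = ex_number r n (dense_family r s t)"
proof -
  define Z where "Z = {card (hedges H) | H :: nat hypergraph. rgraph r H \<and> card (verts H) = n \<and> locally_sparse r s t H}"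
  \<comment> \<open>The edgeless hypergraph is admissible because \<open>s > 0\<close>, so
    \<open>Max\<close> ranges over a nonempty set.\<close>
  have "0 < s / real r * real (card U)" if "U \<subseteq> {..<n}" "U \<noteq> {}" for U
    using that assms finite_subset[OF that(1)] by (simp add: card_gt_0_iff)
  then have "locally_sparse r s t ({..<n}, {})" by (simp add: locally_sparse_def)
  moreover have "rgraph r ({..<n}, {})" by (simp add: rgraph_def)
  ultimately have "Z \<noteq> {}" unfolding Z_def by fastforce
  then have "Max Z \<in> Z" using finite_ex_number_values unfolding Z_def by (intro Max_in)
  then have "ex_number r n (dense_family r s t) \<in> Z" using ex_number_eq[OF assms(1)] by (simp add: Z_def)
  then show ?thesis unfolding Z_def by force
qed

lemma ex_number_ge:
  fixes H :: "nat hypergraph"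
  assumes "r > 0" "rgraph r H" "card (verts H) = n" "locally_sparse r s t H"
  shows "card (hedges H) \<le> ex_number r n (dense_family r s t)"
  unfolding ex_number_eq[OF assms(1)]
  using assms by (intro Max_ge finite_ex_number_values) blast

lemma ex_number_antimono:
  assumes "r > 0" "s > 0" "t \<le> t'"
  shows "ex_number r n (dense_family r s t') \<le> ex_number r n (dense_family r s t)"
proof -
  obtain H :: "nat hypergraph" where H: "rgraph r H" "card (verts H) = n" "locally_sparse r s t' H"
      "card (hedges H) = ex_number r n (dense_family r s t')"
    using ex_number_attained[OF assms(1,2)] by blast
  have "locally_sparse r s t H" using H(3) assms(3) by (auto simp: locally_sparse_def)
  then show ?thesis using ex_number_ge[OF assms(1) H(1,2)] H(4) by metis
qed

section \<open>Polynomial bounds for the extremal number\<close>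

lemma ex_number_lower:
  assumes "r > 0" "s > 1"
  shows "\<forall>\<^sub>F n in sequentially.
    1 / real r * real n powr (real r - real r / s) \<le> real (ex_number r n (dense_family r s t))"
proof -
  \<comment> \<open>The exponent is positive, so the main term outgrows the constant cost of the
    deletions.\<close>
  have "real r / s < real r / 1" using assms by (intro divide_strict_left_mono) auto
  then have "\<forall>\<^sub>F n in sequentially. \<exists>E \<subseteq> {e. e \<subseteq> {..<n} \<and> card e = r}.
           (\<forall>U \<subseteq> {..<n}. U \<noteq> {} \<longrightarrow> card U \<le> t \<longrightarrow> real (card {e \<in> E. e \<subseteq> U}) < s / real r * real (card U)) \<and>
           1 / real r * real n powr (real r - 1 / (s / real r)) \<le> real (card E)"
    using assms by (intro sparse_set_system) auto
  then show ?thesis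
  proof (rule eventually_mono)
    fix n assume "\<exists>E \<subseteq> {e. e \<subseteq> {..<n} \<and> card e = r}.
           (\<forall>U \<subseteq> {..<n}. U \<noteq> {} \<longrightarrow> card U \<le> t \<longrightarrow> real (card {e \<in> E. e \<subseteq> U}) < s / real r * real (card U)) \<and>
           1 / real r * real n powr (real r - 1 / (s / real r)) \<le> real (card E)"
    then obtain E where E: "E \<subseteq> {e. e \<subseteq> {..<n} \<and> card e = r}"
      "\<forall>U \<subseteq> {..<n}. U \<noteq> {} \<longrightarrow> card U \<le> t \<longrightarrow> real (card {e \<in> E. e \<subseteq> U}) < s / real r * real (card U)"
      "1 / real r * real n powr (real r - 1 / (s / real r)) \<le> real (card E)" by blast
    have "card (hedges ({..<n}, E)) \<le> ex_number r n (dense_family r s t)"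
      using E assms by (intro ex_number_ge) (auto simp: rgraph_def locally_sparse_def)
    then show "1 / real r * real n powr (real r - real r / s) \<le> real (ex_number r n (dense_family r s t))"
      using E(3) by simp
  qed
qed

text \<open>An extremal hypergraph is locally sparse, whereas with too many edges
  \<open>dense_subset_asymptotic\<close> would find a small dense set in it. The hypothesis on
  \<open>s\<close> is the condition \<open>1 / \<rho> < r - 1\<close> for
  \<open>\<rho> = s / r\<close>.\<close>

lemma ex_number_upper:
  assumes r: "r > 1" and s: "s > real r / (real r - 1)" and \<epsilon>: "\<epsilon> > 0"
  shows "\<exists>T>0. \<forall>\<^sub>F n in sequentially.
    real (ex_number r n (dense_family r s T)) < 1 / real r * real n powr (real r - real r / s + \<epsilon>)"
proof -
  have s0: "s > 0" using s r by (smt (verit) divide_pos_pos of_nat_1 of_nat_less_iff)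
  have "real r < s * (real r - 1)" using s r by (simp add: pos_divide_less_eq)
  then have "1 / (s / real r) < real r - 1" using s0 by (simp add: pos_divide_less_eq mult.commute)
  moreover have "s / real r > 0" using s0 r by simp
  ultimately obtain T where T: "T > 0" and ev: "\<forall>\<^sub>F n in sequentially. \<forall>(V :: nat set) E. finite V \<longrightarrow> card V = n \<longrightarrow>
           E \<subseteq> {e. e \<subseteq> V \<and> card e = r} \<longrightarrow> 1 / real r * real n powr (real r - 1 / (s / real r) + \<epsilon>) \<le> real (card E) \<longrightarrow>
           (\<exists>U \<subseteq> V. U \<noteq> {} \<and> card U \<le> T \<and> s / real r * real (card U) \<le> real (card {e \<in> E. e \<subseteq> U}))"
    using dense_subset_asymptotic[of "s / real r" r \<epsilon>] \<epsilon> by blast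
  have "\<forall>\<^sub>F n in sequentially.
    real (ex_number r n (dense_family r s T)) < 1 / real r * real n powr (real r - real r / s + \<epsilon>)"
  proof (rule eventually_mono[OF ev], rule ccontr)
    fix n assume *: "\<forall>(V :: nat set) E. finite V \<longrightarrow> card V = n \<longrightarrow>
           E \<subseteq> {e. e \<subseteq> V \<and> card e = r} \<longrightarrow> 1 / real r * real n powr (real r - 1 / (s / real r) + \<epsilon>) \<le> real (card E) \<longrightarrow>
           (\<exists>U \<subseteq> V. U \<noteq> {} \<and> card U \<le> T \<and> s / real r * real (card U) \<le> real (card {e \<in> E. e \<subseteq> U}))"
      and many: "\<not> real (ex_number r n (dense_family r s T)) < 1 / real r * real n powr (real r - real r / s + \<epsilon>)"
    obtain H :: "nat hypergraph" where H: "rgraph r H" "card (verts H) = n" "locally_sparse r s T H"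
      "card (hedges H) = ex_number r n (dense_family r s T)"
      using ex_number_attained[of r s] s0 r by fastforce
    have "\<exists>U \<subseteq> verts H. U \<noteq> {} \<and> card U \<le> T \<and> s / real r * real (card U) \<le> real (card {e \<in> hedges H. e \<subseteq> U})"
      using *[rule_format, of "verts H" "hedges H"] H many by (simp add: rgraph_def)
    then show False using H(3) unfolding locally_sparse_def by (meson not_less)
  qed
  then show ?thesis using T by blast
qed

section \<open>The limiting exponent\<close>

lemma limsup_ex_number_ge:
  assumes r: "r > 0" and s: "s > 1"
  shows "ereal (real r - real r / s)
    \<le> limsup (\<lambda>n. ereal (ln (real (ex_number r n (dense_family r s t))) / ln (real n)))"
proof (rule ereal_le_epsilon2)
  fix \<delta> :: real assume \<delta>: "\<delta> > 0"
  define c where "c = real r - real r / s"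
  have "\<forall>\<^sub>F n in sequentially. ereal (c - \<delta>) \<le> ereal (ln (real (ex_number r n (dense_family r s t))) / ln (real n))"
    using ex_number_lower[OF r s, of t] eventually_nat_powr_gt[OF \<delta>, of "real r"] eventually_gt_at_top[of 1]
  proof eventually_elim
    fix n assume 1: "1 / real r * real n powr (real r - real r / s) \<le> real (ex_number r n (dense_family r s t))"
      and 2: "real r < real n powr \<delta>" and n: "1 < n"
    \<comment> \<open>The factor \<open>1 / r\<close> is absorbed by \<open>n powr \<delta>\<close>,
      which exceeds \<open>r\<close> for large \<open>n\<close>.\<close>
    have "real n powr (c - \<delta>) = real n powr c / real n powr \<delta>" by (simp add: powr_diff)
    also have "\<dots> \<le> real n powr c / real r" using 2 r n by (intro divide_left_mono mult_pos_pos) auto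
    also have "\<dots> \<le> real (ex_number r n (dense_family r s t))" using 1 by (simp add: c_def)
    finally have "ln (real n powr (c - \<delta>)) \<le> ln (real (ex_number r n (dense_family r s t)))"
      using n by (intro ln_mono) auto
    then show "ereal (c - \<delta>) \<le> ereal (ln (real (ex_number r n (dense_family r s t))) / ln (real n))"
      using n by (simp add: ln_powr pos_le_divide_eq)
  qed
  then have "ereal (c - \<delta>) \<le> limsup (\<lambda>n. ereal (ln (real (ex_number r n (dense_family r s t))) / ln (real n)))"
    by (intro le_Limsup) auto
  then have "ereal (c - \<delta>) + ereal \<delta> \<le> limsup (\<lambda>n. ereal (ln (real (ex_number r n (dense_family r s t))) / ln (real n))) + ereal \<delta>"
    by (rule add_right_mono)
  then show "ereal (real r - real r / s) \<le> limsup (\<lambda>n. ereal (ln (real (ex_number r n (dense_family r s t))) / ln (real n))) + ereal \<delta>"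
    by (simp add: c_def)
qed

text \<open>Forbidding more hypergraphs only lowers the extremal number, so a bound at
  \<open>T\<close> persists for every larger \<open>t\<close>.\<close>

lemma limsup_ex_number_le:
  assumes r: "r > 0" and s: "s > 1" and a: "a \<ge> 0"
    and ev: "\<forall>\<^sub>F n in sequentially. real (ex_number r n (dense_family r s T)) < 1 / real r * real n powr a"
    and t: "T \<le> t"
  shows "limsup (\<lambda>n. ereal (ln (real (ex_number r n (dense_family r s t))) / ln (real n))) \<le> ereal a"
proof (rule Limsup_bounded)
  show "\<forall>\<^sub>F n in sequentially. ereal (ln (real (ex_number r n (dense_family r s t))) / ln (real n)) \<le> ereal a"
    using ev eventually_gt_at_top[of 1]
  proof eventually_elim
    fix n assume 1: "real (ex_number r n (dense_family r s T)) < 1 / real r * real n powr a" and n: "1 < n"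
    define m where "m = ex_number r n (dense_family r s t)"
    have "real m \<le> real (ex_number r n (dense_family r s T))"
      using ex_number_antimono[OF r _ t, of s] s by (simp add: m_def)
    also have "\<dots> \<le> 1 / real r * real n powr a" using 1 by simp
    also have "\<dots> \<le> 1 * real n powr a" using r by (intro mult_right_mono) auto
    finally have m: "real m \<le> real n powr a" by simp
    \<comment> \<open>For \<open>m = 0\<close> the value \<open>ln 0\<close> is 0 by convention, and
      \<open>a \<ge> 0\<close> settles this case.\<close>
    have "ln (real m) \<le> a * ln (real n)"
    proof (cases "m = 0")
      case False
      then have "ln (real m) \<le> ln (real n powr a)" using m by (intro ln_mono) auto
      then show ?thesis using n by (simp add: ln_powr)
    qed (use a n in simp)
    then show "ereal (ln (real (ex_number r n (dense_family r s t))) / ln (real n)) \<le> ereal a"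
      using n by (simp add: pos_divide_le_eq m_def)
  qed
qed

theorem mainTheorem4:
  fixes r :: nat and s :: real
  assumes "r \<ge> 3" and "s > real r / (real r - 1)"
  shows "(\<forall>t::nat. t > 0 \<longrightarrow>
            (\<forall>\<^sub>F n in sequentially.
               real (ex_number r n (dense_family r s t))
                 \<ge> 1 / real r * real n powr (real r - real r / s))) \<and>
         (\<forall>\<epsilon>::real. \<epsilon> > 0 \<longrightarrow>
            (\<exists>T::nat. T > 0 \<and>
               (\<forall>\<^sub>F n in sequentially.
                  real (ex_number r n (dense_family r s T))
                    < 1 / real r * real n powr (real r - real r / s + \<epsilon>)))) \<and>
         ((\<lambda>t::nat. limsup (\<lambda>n::nat.
              ereal (ln (real (ex_number r n (dense_family r s t))) / ln (real n))))
            \<longlonglongrightarrow> ereal (real r - real r / s))"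
proof -
  define c where "c = real r - real r / s"
  have r0: "r > 0" "r > 1" using assms(1) by simp_all
  have "1 < real r / (real r - 1)" using assms(1) by (simp add: less_divide_eq)
  then have s1: "s > 1" using assms(2) by linarith
  have "real r / s \<le> real r / 1" using s1 by (intro divide_left_mono) auto
  then have c0: "c \<ge> 0" by (simp add: c_def)
  note lower = ex_number_lower[OF r0(1) s1]
  note upper = ex_number_upper[OF r0(2) assms(2)]
  have lim: "(\<lambda>t. limsup (\<lambda>n. ereal (ln (real (ex_number r n (dense_family r s t))) / ln (real n))))
      \<longlonglongrightarrow> ereal c"
  proof (rule order_tendstoI)
    fix a assume "a < ereal c"
    then show "\<forall>\<^sub>F t in sequentially.
        a < limsup (\<lambda>n. ereal (ln (real (ex_number r n (dense_family r s t))) / ln (real n)))"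
      \<comment> \<open>The lower estimate holds for every \<open>t\<close>; only the upper one
        requires \<open>t\<close> to be large.\<close>
      using limsup_ex_number_ge[OF r0(1) s1] unfolding c_def by (intro always_eventually allI) (rule less_le_trans)
  next
    fix a assume "ereal c < a"
    then obtain z where z: "c < z" "ereal z < a" using ereal_dense2 by force
    \<comment> \<open>The gap between \<open>c\<close> and \<open>z\<close> serves as the \<epsilon>
      of the upper bound.\<close>
    obtain T where T: "\<forall>\<^sub>F n in sequentially.
        real (ex_number r n (dense_family r s T)) < 1 / real r * real n powr z"
      using upper[of "z - c"] z(1) by (auto simp: c_def)
    have "limsup (\<lambda>n. ereal (ln (real (ex_number r n (dense_family r s t))) / ln (real n))) \<le> ereal z"
      if "T \<le> t" for t
      using limsup_ex_number_le[OF r0(1) s1 _ T that] c0 z(1) by simp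
    then show "\<forall>\<^sub>F t in sequentially.
        limsup (\<lambda>n. ereal (ln (real (ex_number r n (dense_family r s t))) / ln (real n))) < a"
      using z(2) by (intro eventually_sequentiallyI[of T]) (rule le_less_trans)
  qed
  show ?thesis
    using lower upper lim unfolding c_def by blast
qed

end
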